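(* Let $\chi$ be a non-principal Dirichlet character of modulus $k$, and for $\chi(n)\neq0$ write $\chi(n)=e^{i\theta_n}$. Let $(r_n)_{n\ge3}$ be independent uniform random variables on $[0,1]$, let $\mathbb{P}'=\{n\ge3: r_n\le 1/\log n\}=\{p'_1<p'_2<\cdots\}$, let $z_{n,k}=1$ if $r_n\le 1/\log n$ and $\gcd(n,k)=1$ and $z_{n,k}=0$ otherwise, and let $C'_N=\sum_{n=3}^{p'_N} z_{n,k}\cos\theta_n$. Then for any $\epsilon>0$, in the limit $N\to\infty$, $C'_N=O(N^{1/2+\epsilon})$ with probability equal to $1$.
   Context: This is a variant of Cramér's random model for the primes: each integer $n\ge3$ is a "pseudo-prime" independently with probability $1/\log n$. *)

theory Defs
  imports "HOL-Probability.Probability"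
begin

definition dirichlet_character :: "nat \<Rightarrow> (nat \<Rightarrow> complex) \<Rightarrow> bool" where
  "dirichlet_character k chi \<longleftrightarrow>
     k > 0 \<and>
     (\<forall>m n. chi (m * n) = chi m * chi n) \<and>
     (\<forall>n. chi (n + k) = chi n) \<and>
     (\<forall>n. chi n \<noteq> 0 \<longleftrightarrow> coprime n k)"

definition principal_character :: "nat \<Rightarrow> nat \<Rightarrow> complex" where
  "principal_character k n = (if coprime n k then 1 else 0)"

text \<open>In the following definitions, \<open>x\<close> is a single realisation
  \<open>\<lambda>n. r n \<omega>\<close> of the random sequence.\<close>

definition pseudo_primes :: "(nat \<Rightarrow> real) \<Rightarrow> nat set" where
  "pseudo_primes x = {n. n \<ge> 3 \<and> x n \<le> 1 / ln (real n)}"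

text \<open>The sequence of pseudo-primes is indexed from 1, whereas \<^const>\<open>enumerate\<close> starts at 0.
  The value is meaningful only for \<open>N \<ge> 1\<close> and infinite \<open>pseudo_primes x\<close>.\<close>

definition pseudo_prime :: "(nat \<Rightarrow> real) \<Rightarrow> nat \<Rightarrow> nat" where
  "pseudo_prime x N = enumerate (pseudo_primes x) (N - 1)"

definition pseudo_z :: "(nat \<Rightarrow> real) \<Rightarrow> nat \<Rightarrow> nat \<Rightarrow> real" where
  "pseudo_z x k n = (if x n \<le> 1 / ln (real n) \<and> coprime n k then 1 else 0)"

definition pseudo_C :: "nat \<Rightarrow> (nat \<Rightarrow> real) \<Rightarrow> (nat \<Rightarrow> real) \<Rightarrow> nat \<Rightarrow> real" where
  "pseudo_C k \<theta> x N = (\<Sum>n = 3..pseudo_prime x N. pseudo_z x k n * cos (\<theta> n))"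

end

theory Submission imports Defs "HOL-Number_Theory.Cong" "HOL-Real_Asymp.Real_Asymp" begin

text \<open>Write \<open>C'\<^sub>N\<close> as the sum over \<open>n \<le> p'\<^sub>N\<close> of \<open>Re (chi n)\<close> times the indicator of
  \<open>r\<^sub>n \<le> 1 / ln n\<close>. Its mean is bounded for every fixed upper limit \<open>m\<close>, by partial summation,
  because a non-principal character sums to \<open>0\<close> over a period. Hoeffding's inequality and
  Borel-Cantelli bound the fluctuation by \<open>m powr (1/2 + \<delta>)\<close> for all large \<open>m\<close>, almost surely;
  as this is uniform in \<open>m\<close>, the random limit \<open>m = p'\<^sub>N\<close> may be inserted. The same estimate with
  all weights \<open>1\<close> shows that there are at least \<open>m powr (1 - \<delta>)\<close> pseudo-primes up to \<open>m\<close>, so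
  that \<open>p'\<^sub>N \<le> N powr (1 / (1 - \<delta>))\<close>.\<close>

lemma periodic_mod:
  fixes f :: "nat \<Rightarrow> 'a"
  assumes "\<And>n. f (n + k) = f n"
  shows "f (n mod k) = f n"
proof -
  have "f (m + j * k) = f m" for m j
  proof (induction j)
    case (Suc j)
    have "f (m + Suc j * k) = f ((m + j * k) + k)" by (simp add: algebra_simps)
    then show ?case using assms Suc by simp
  qed simp
  from this[of "n mod k" "n div k"] show ?thesis by (simp add: mod_mult_div_eq)
qed

text \<open>Multiplication by a unit \<open>a\<close> with \<open>chi a \<noteq> 1\<close> permutes
  the residues modulo \<open>k\<close>, so the sum equals \<open>chi a\<close> times itself.\<close>

lemma sum_nonprincipal_character_eq_0:
  assumes chi: "dirichlet_character k chi" and "chi \<noteq> principal_character k"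
  shows "(\<Sum>n<k. chi n) = 0"
proof -
  from chi have k: "k > 0" and mult: "\<And>m n. chi (m * n) = chi m * chi n"
    and per: "\<And>n. chi (n + k) = chi n" and nz: "\<And>n. chi n \<noteq> 0 \<longleftrightarrow> coprime n k"
    by (auto simp: dirichlet_character_def)
  from assms(2) obtain a where "chi a \<noteq> principal_character k a" by auto
  \<comment> \<open>Both characters vanish off the residues coprime to \<open>k\<close>, so they can
    differ only at a unit.\<close>
  then have a: "coprime a k" "chi a \<noteq> 1"
    using nz by (auto simp: principal_character_def split: if_splits)
  have "inj_on (\<lambda>n. a * n mod k) {..<k}"
  proof (rule inj_onI)
    fix x y assume xy: "x \<in> {..<k}" "y \<in> {..<k}" "a * x mod k = a * y mod k"
    then have "[a * x = a * y] (mod k)" by (simp add: cong_def)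
    then have "[x = y] (mod k)" using a(1) by (simp add: cong_mult_lcancel_nat)
    then show "x = y" using xy by (simp add: cong_def)
  qed
  moreover have "(\<lambda>n. a * n mod k) ` {..<k} \<subseteq> {..<k}" using k by auto
  ultimately have bij: "bij_betw (\<lambda>n. a * n mod k) {..<k} {..<k}"
    by (simp add: bij_betw_def endo_inj_surj)
  have "chi a * (\<Sum>n<k. chi n) = (\<Sum>n<k. chi (a * n mod k))"
    by (simp add: sum_distrib_left mult periodic_mod[of chi, OF per])
  also have "\<dots> = (\<Sum>n<k. chi n)"
    by (rule sum.reindex_bij_betw[OF bij])
  finally show ?thesis using a(2) by simp
qed

text \<open>Full periods cancel, which leaves fewer than \<open>k\<close> terms of norm at most
  1.\<close>

lemma norm_sum_periodic_le:
  fixes f :: "nat \<Rightarrow> 'a :: real_normed_vector"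
  assumes per: "\<And>n. f (n + k) = f n" and zero: "(\<Sum>n<k. f n) = 0"
    and k: "k > 0" and bd: "\<And>n. norm (f n) \<le> 1"
  shows "norm (\<Sum>n<m. f n) \<le> real k"
proof (induction m rule: less_induct)
  case (less m)
  show ?case
  proof (cases "m < k")
    case True
    have "norm (\<Sum>n<m. f n) \<le> (\<Sum>n<m. 1)" by (rule order.trans[OF norm_sum sum_mono]) (rule bd)
    with True show ?thesis by simp
  next
    case False
    have "(\<Sum>n<m. f n) = (\<Sum>n<k + (m - k). f n)" using False by simp
    also have "\<dots> = (\<Sum>n<k. f n) + (\<Sum>n<m - k. f (n + k))"
      unfolding lessThan_atLeast0
      by (subst sum.atLeastLessThan_concat[symmetric, of 0 k "k + (m - k)"])
         (use sum.shift_bounds_nat_ivl[of f 0 k "m - k"] in \<open>simp_all add: add.commute\<close>)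
    also have "\<dots> = (\<Sum>n<m - k. f n)" by (simp add: zero per)
    finally show ?thesis using less.IH[of "m - k"] False k by simp
  qed
qed

text \<open>Abel summation: the decrements of \<open>b\<close> are nonnegative and telescope, so the
  bound on the partial sums costs only the factor \<open>b s\<close>.\<close>

lemma abs_sum_decreasing_weights_le:
  fixes a b :: "nat \<Rightarrow> real"
  assumes bd: "\<And>m. \<bar>\<Sum>n=s..m. a n\<bar> \<le> B"
    and dec: "\<And>n. n \<ge> s \<Longrightarrow> b (Suc n) \<le> b n" and nonneg: "\<And>n. n \<ge> s \<Longrightarrow> b n \<ge> 0"
  shows "\<bar>\<Sum>n=s..m. a n * b n\<bar> \<le> B * b s"
proof (cases "s \<le> m")
  case True
  define A where "A m = (\<Sum>n=s..m. a n)" for m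
  \<comment> \<open>Splitting off the boundary term \<open>A m * b m\<close> makes the induction
    work: each step adds just \<open>A m * (b m - b (Suc m))\<close>.\<close>
  have "\<bar>(\<Sum>n=s..m. a n * b n) - A m * b m\<bar> \<le> B * (b s - b m)"
    using True
  proof (induction m rule: dec_induct)
    case base
    then show ?case by (simp add: A_def)
  next
    case (step m)
    have "(\<Sum>n=s..Suc m. a n * b n) - A (Suc m) * b (Suc m) =
          ((\<Sum>n=s..m. a n * b n) - A m * b m) + A m * (b m - b (Suc m))"
      using step.hyps by (simp add: A_def algebra_simps)
    also have "\<bar>\<dots>\<bar> \<le> B * (b s - b m) + \<bar>A m * (b m - b (Suc m))\<bar>"
      using step.IH by linarith
    also have "\<bar>A m * (b m - b (Suc m))\<bar> \<le> B * (b m - b (Suc m))"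
      unfolding abs_mult A_def using dec[of m] step.hyps bd[of m]
      by (intro mult_mono) auto
    finally show ?case by (simp add: algebra_simps)
  qed
  moreover have "\<bar>A m * b m\<bar> \<le> B * b m"
    unfolding abs_mult A_def using nonneg[OF True] bd[of m]
    by (intro mult_mono) auto
  ultimately show ?thesis by (simp add: algebra_simps)
next
  case False
  have "B \<ge> 0" using bd[of m] by linarith
  with False nonneg[of s] show ?thesis by simp
qed

text \<open>The extra factor \<open>m powr \<delta>\<close> over the typical size of order
  \<open>sqrt m\<close> makes the Hoeffding tails summable over \<open>m\<close>, as Borel-Cantelli
  requires.\<close>

lemma (in prob_space) AE_eventually_abs_sum_deviation_le:
  fixes X :: "nat \<Rightarrow> 'a \<Rightarrow> real" and \<delta> :: real
  assumes indep: "indep_vars (\<lambda>_. borel) X {s..}" and s: "s \<ge> 1"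
    and bd: "\<And>n x. n \<ge> s \<Longrightarrow> \<bar>X n x\<bar> \<le> 1" and \<delta>: "\<delta> > 0"
  shows "AE x in M. \<forall>\<^sub>F m in sequentially.
    \<bar>(\<Sum>n=s..m. X n x) - (\<Sum>n=s..m. expectation (X n))\<bar> \<le> real m powr (1/2 + \<delta>)"
proof -
  have meas: "X n \<in> borel_measurable M" if "n \<ge> s" for n
    using indep that by (auto simp: indep_vars_def)
  define E where "E m = {x \<in> space M.
    \<bar>(\<Sum>n=s..m. X n x) - (\<Sum>n=s..m. expectation (X n))\<bar> \<ge> real m powr (1/2 + \<delta>)}" for m
  have sets: "E m \<in> sets M" for m
  proof -
    have "(\<lambda>x. \<Sum>n=s..m. X n x) \<in> borel_measurable M"
      by (rule borel_measurable_sum) (auto intro: meas)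
    then show ?thesis unfolding E_def by measurable
  qed
  have prob: "prob (E m) \<le> 2 * exp (- (real m powr (2 * \<delta>) / 2))" if m: "m \<ge> s" for m
  proof -
    interpret Hoeffding_ineq M "{s..m}" X "\<lambda>_. -1" "\<lambda>_. 1" "\<Sum>n=s..m. expectation (X n)"
    proof (unfold_locales)
      show "indep_vars (\<lambda>_. borel) X {s..m}"
        by (rule indep_vars_subset[OF indep]) auto
      show "AE x in M. X i x \<in> {- 1..1}" if "i \<in> {s..m}" for i
        using bd that by (auto simp: abs_le_iff minus_le_iff)
    qed auto
    \<comment> \<open>Each variable ranges in an interval of length 2 and contributes 4; as
      \<open>s \<ge> 1\<close>, there are at most \<open>m\<close> of them.\<close>
    define d where "d = real (Suc m - s) * 4"
    have d: "d > 0" "d \<le> 4 * real m" using m s by (auto simp: d_def)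
    have "prob (E m) \<le> 2 * exp (- 2 * (real m powr (1/2 + \<delta>))\<^sup>2 / (\<Sum>i\<in>{s..m}. (1 - - 1)\<^sup>2))"
      unfolding E_def by (rule Hoeffding_ineq_abs_ge) (use m in auto)
    also have "(\<Sum>i\<in>{s..m}. (1 - - 1 :: real)\<^sup>2) = d"
      by (simp add: d_def)
    also have "(real m powr (1/2 + \<delta>))\<^sup>2 = real m powr (2 * \<delta>) * real m"
      using m s by (simp add: power2_eq_square powr_add[symmetric] powr_mult_base[symmetric] mult.commute)
    also have "2 * exp (- 2 * (real m powr (2 * \<delta>) * real m) / d) \<le>
               2 * exp (- (real m powr (2 * \<delta>) / 2))"
    proof -
      have "real m powr (2 * \<delta>) * d \<le> real m powr (2 * \<delta>) * (4 * real m)"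
        using d by (intro mult_left_mono) auto
      then show ?thesis using d by (simp add: field_simps)
    qed
    finally show ?thesis .
  qed
  \<comment> \<open>The tail decays faster than every power of \<open>m\<close>; the exponent -2 is
    a convenient summable one.\<close>
  have "(\<lambda>m. 2 * exp (- (real m powr (2 * \<delta>) / 2))) \<in> O(\<lambda>m. real m powr - 2)"
    using \<delta> by real_asymp
  moreover have "summable (\<lambda>m. norm (real m powr - 2))"
    by (simp add: summable_real_powr_iff)
  ultimately have "summable (\<lambda>m. 2 * exp (- (real m powr (2 * \<delta>) / 2)))"
    by (rule summable_comparison_test_bigo[rotated])
  then have "summable (\<lambda>m. prob (E m))"
    by (rule summable_comparison_test_ev[rotated])
       (use prob in \<open>auto intro!: eventually_sequentiallyI[of s]\<close>)
  then have "AE x in M. \<forall>\<^sub>F m in sequentially. x \<in> space M - E m"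
    by (intro borel_cantelli_AE1 sets) (auto simp: emeasure_eq_measure)
  then show ?thesis
    by (rule eventually_mono) (auto elim!: eventually_mono simp: E_def)
qed

text \<open>The uniform law gives \<open>{..t}\<close> the length of \<open>{0..t}\<close>. This
  identifies the means in the deviation estimate.\<close>

lemma (in prob_space) expectation_weighted_uniform_threshold:
  fixes r :: "'a \<Rightarrow> real" and c t :: real
  assumes r: "r \<in> borel_measurable M" and distr: "distr M borel r = uniform_measure lborel {0..1}"
    and t: "0 \<le> t" "t \<le> 1"
  shows "expectation (\<lambda>x. c * (if r x \<le> t then 1 else 0)) = c * t"
proof -
  have "expectation (\<lambda>x. if r x \<le> t then 1 else 0 :: real) =
        expectation (indicator (r -` {..t} \<inter> space M))"
    by (intro Bochner_Integration.integral_cong) (auto simp: indicator_def)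
  also have "\<dots> = prob (r -` {..t} \<inter> space M)"
    using r by simp
  also have "\<dots> = measure (distr M borel r) {..t}"
    using r by (simp add: measure_distr)
  also have "\<dots> = measure lborel ({0..1} \<inter> {..t}) / measure lborel {0..1::real}"
    unfolding distr by (rule measure_uniform_measure) auto
  also have "{0..1} \<inter> {..t} = {0..t}" using t by auto
  finally show ?thesis using t by simp
qed

text \<open>Enumeration is increasing and starts at index 0. Through this identity a lower bound for
  the count of pseudo-primes bounds the \<open>N\<close>-th one from above.\<close>

lemma card_le_enumerate:
  fixes S :: "nat set"
  assumes "infinite S"
  shows "card {n \<in> S. n \<le> enumerate S j} = Suc j"
proof -
  have "{n \<in> S. n \<le> enumerate S j} = enumerate S ` {..j}"
    using enumerate_Ex assms enumerate_in_set by fastforce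
  then show ?thesis
    using inj_enumerate[OF assms] by (simp add: card_image inj_on_def)
qed

theorem theorem2:
  fixes k :: nat and chi :: "nat \<Rightarrow> complex" and \<theta> :: "nat \<Rightarrow> real"
    and M :: "'a measure" and r :: "nat \<Rightarrow> 'a \<Rightarrow> real" and \<epsilon> :: real
  assumes "dirichlet_character k chi"
    and "chi \<noteq> principal_character k"
    and "\<And>n. chi n \<noteq> 0 \<Longrightarrow> chi n = exp (\<i> * complex_of_real (\<theta> n))"
    and "prob_space M"
    and "prob_space.indep_vars M (\<lambda>_. borel) r {3..}"
    and "\<And>n. n \<ge> 3 \<Longrightarrow> distr M borel (r n) = uniform_measure lborel {0..1}"
    and "\<epsilon> > 0"
  shows "AE \<omega> in M.
           (\<lambda>N. pseudo_C k \<theta> (\<lambda>n. r n \<omega>) N) \<in> O(\<lambda>N. real N powr (1/2 + \<epsilon>))"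
proof -
  interpret prob_space M by fact
  from assms(1) have k: "k > 0" and per: "\<And>n. chi (n + k) = chi n"
    and nz: "\<And>n. chi n \<noteq> 0 \<longleftrightarrow> coprime n k"
    by (auto simp: dirichlet_character_def)
  define p where "p n = 1 / ln (real n)" for n
  define a where "a n = Re (chi n)" for n
  \<comment> \<open>The coprimality condition of \<open>pseudo_z\<close> is carried by
    \<open>a\<close>, so the same \<open>X\<close> serves the character sum and the plain
    count.\<close>
  define X where "X n \<omega> = (if r n \<omega> \<le> p n then 1 else 0 :: real)" for n \<omega>

  have norm_chi: "norm (chi n) \<le> 1" for n
    using assms(3)[of n] by (cases "chi n = 0") (auto simp: norm_exp_i_times)
  have a_le: "\<bar>a n\<bar> \<le> 1" for n
    using abs_Re_le_cmod[of "chi n"] norm_chi[of n] by (simp add: a_def)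
  have a_eq: "a n = (if coprime n k then cos (\<theta> n) else 0)" for n
    using assms(3)[of n] nz[of n] by (auto simp: a_def Re_exp)

  \<comment> \<open>Since e is at most 3, \<open>p n\<close> is a probability from the first index
    on.\<close>
  have ln3: "ln (3::real) \<ge> 1"
    using exp_le by (subst ln_ge_iff) auto
  have p_bounds: "0 \<le> p n" "p n \<le> 1" if "n \<ge> 3" for n
  proof -
    have "ln (real n) \<ge> ln 3" using that by (subst ln_le_cancel_iff) auto
    with ln3 have "ln (real n) \<ge> 1" by linarith
    then show "0 \<le> p n" "p n \<le> 1" by (auto simp: p_def)
  qed
  have p_dec: "p m \<le> p n" if "n \<ge> 3" "n \<le> m" for m n
    using that unfolding p_def by (intro divide_left_mono) auto

  \<comment> \<open>A sum starting at 3 is a difference of two initial sums, each at most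
    \<open>k\<close> in absolute value.\<close>
  have A: "\<bar>\<Sum>n=3..m. a n\<bar> \<le> 2 * real k" for m
  proof -
    have P: "\<bar>\<Sum>n<j. a n\<bar> \<le> real k" for j
    proof -
      have "\<bar>\<Sum>n<j. a n\<bar> = \<bar>Re (\<Sum>n<j. chi n)\<bar>" by (simp add: a_def)
      also have "\<dots> \<le> norm (\<Sum>n<j. chi n)" by (rule abs_Re_le_cmod)
      also have "\<dots> \<le> real k"
        by (rule norm_sum_periodic_le[OF per sum_nonprincipal_character_eq_0[OF assms(1,2)] k norm_chi])
      finally show ?thesis .
    qed
    show ?thesis
    proof (cases "m \<ge> 3")
      case True
      have "(\<Sum>n<Suc m. a n) = (\<Sum>n<3. a n) + (\<Sum>n=3..m. a n)"
        using True unfolding lessThan_atLeast0 atLeastLessThanSuc_atLeastAtMost[symmetric]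
        by (subst sum.atLeastLessThan_concat) auto
      then show ?thesis using P[of "Suc m"] P[of 3] by linarith
    qed auto
  qed
  have mean: "\<bar>\<Sum>n=3..m. a n * p n\<bar> \<le> 2 * real k" for m
  proof -
    have "\<bar>\<Sum>n=3..m. a n * p n\<bar> \<le> 2 * real k * p 3"
      by (rule abs_sum_decreasing_weights_le[OF A]) (use p_dec p_bounds in auto)
    also have "\<dots> \<le> 2 * real k * 1" using p_bounds[of 3] by (intro mult_left_mono) auto
    finally show ?thesis by simp
  qed

  have conc: "AE \<omega> in M. \<forall>\<^sub>F m in sequentially.
      \<bar>(\<Sum>n=3..m. c n * X n \<omega>) - (\<Sum>n=3..m. c n * p n)\<bar> \<le> real m powr (1/2 + d)"
    if c: "\<And>n. \<bar>c n\<bar> \<le> 1" and d: "d > 0" for c :: "nat \<Rightarrow> real" and d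
  proof -
    have rv: "r n \<in> borel_measurable M" if "n \<ge> 3" for n
      using assms(5) that by (auto simp: indep_vars_def)
    have "indep_vars (\<lambda>_. borel) (\<lambda>n \<omega>. c n * X n \<omega>) {3..}"
      unfolding X_def
      by (rule indep_vars_compose2[OF assms(5), of "\<lambda>n y. c n * (if y \<le> p n then 1 else 0)"])
         measurable
    from AE_eventually_abs_sum_deviation_le[OF this _ _ d]
    have "AE \<omega> in M. \<forall>\<^sub>F m in sequentially.
      \<bar>(\<Sum>n=3..m. c n * X n \<omega>) - (\<Sum>n=3..m. expectation (\<lambda>\<omega>. c n * X n \<omega>))\<bar>
        \<le> real m powr (1/2 + d)"
      using c by (simp add: X_def)
    moreover have "(\<Sum>n=3..m. expectation (\<lambda>\<omega>. c n * X n \<omega>)) = (\<Sum>n=3..m. c n * p n)" for m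
      unfolding X_def using rv assms(6) p_bounds
      by (intro sum.cong refl expectation_weighted_uniform_threshold) auto
    ultimately show ?thesis by (simp only:)
  qed

  \<comment> \<open>chosen so that \<open>(1/2 + \<delta>) / (1 - \<delta>) = 1/2 + \<epsilon>\<close>\<close>
  define \<delta> where "\<delta> = \<epsilon> / (3/2 + \<epsilon>)"
  have \<delta>: "0 < \<delta>" "\<delta> < 1" using \<open>\<epsilon> > 0\<close> by (auto simp: \<delta>_def field_simps)
  have \<delta>_eq: "1/2 + \<delta> = (1 - \<delta>) * (1/2 + \<epsilon>)"
    using \<open>\<epsilon> > 0\<close> by (simp add: \<delta>_def field_simps)

  have "AE \<omega> in M. \<forall>\<^sub>F m in sequentially.
      \<bar>(\<Sum>n=3..m. a n * X n \<omega>) - (\<Sum>n=3..m. a n * p n)\<bar> \<le> real m powr (1/2 + \<delta>)"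
    by (rule conc[OF a_le \<delta>(1)])
  \<comment> \<open>The exponent 3/4 only has to be below 1: the mean count is at least of order
    \<open>m / ln m\<close>, which dominates such an error.\<close>
  moreover have "AE \<omega> in M. \<forall>\<^sub>F m in sequentially.
      \<bar>(\<Sum>n=3..m. 1 * X n \<omega>) - (\<Sum>n=3..m. 1 * p n)\<bar> \<le> real m powr (1/2 + 1/4)"
    by (rule conc) auto
  ultimately show ?thesis
  proof eventually_elim
    fix \<omega>
    assume devC: "\<forall>\<^sub>F m in sequentially.
      \<bar>(\<Sum>n=3..m. a n * X n \<omega>) - (\<Sum>n=3..m. a n * p n)\<bar> \<le> real m powr (1/2 + \<delta>)"
    assume devPi: "\<forall>\<^sub>F m in sequentially.
      \<bar>(\<Sum>n=3..m. 1 * X n \<omega>) - (\<Sum>n=3..m. 1 * p n)\<bar> \<le> real m powr (1/2 + 1/4)"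
    define S where "S = pseudo_primes (\<lambda>n. r n \<omega>)"
    define q where "q = pseudo_prime (\<lambda>n. r n \<omega>)"
    have count: "(\<Sum>n=3..m. X n \<omega>) = real (card {n\<in>S. n \<le> m})" for m
    proof -
      have "(\<Sum>n=3..m. X n \<omega>) = real (card {n \<in> {3..m}. r n \<omega> \<le> p n})"
        by (simp add: X_def sum.If_cases Int_def)
      also have "{n \<in> {3..m}. r n \<omega> \<le> p n} = {n\<in>S. n \<le> m}"
        by (auto simp: S_def pseudo_primes_def p_def)
      finally show ?thesis .
    qed
    have lower: "\<forall>\<^sub>F m in sequentially. real m powr (1 - \<delta>) \<le> real (card {n\<in>S. n \<le> m})"
    proof -
      \<comment> \<open>The mean count has \<open>m - 2\<close> terms, each at least
        \<open>p m\<close>. Half of this bound absorbs the deviation, the other half exceeds the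
        claimed power.\<close>
      have "\<forall>\<^sub>F m in sequentially. real m powr (1 - \<delta>) \<le> (real m - 2) / ln (real m) / 2"
        using \<delta> by real_asymp
      moreover have "\<forall>\<^sub>F m in sequentially. real m powr (3/4) \<le> (real m - 2) / ln (real m) / 2"
        by real_asymp
      ultimately show ?thesis using devPi eventually_ge_at_top[of 3]
      proof eventually_elim
        case (elim m)
        have "(real m - 2) / ln (real m) = (\<Sum>n=3..m. p m)"
          using elim(4) by (simp add: p_def of_nat_diff)
        also have "\<dots> \<le> (\<Sum>n=3..m. p n)" by (intro sum_mono p_dec) auto
        finally show ?case using elim(1-3) by (simp add: count abs_le_iff)
      qed
    qed
    \<comment> \<open>Infinitude makes every value of \<open>q\<close> from index 1 on a true
      pseudo-prime; a finite \<open>S\<close> could not keep up with a growing power of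
      \<open>m\<close>.\<close>
    have inf: "infinite S"
    proof
      assume fin: "finite S"
      have "\<forall>\<^sub>F m in sequentially. real (card S) < real m powr (1 - \<delta>)"
        using \<delta> by real_asymp
      with lower have "\<forall>\<^sub>F m in sequentially. False"
      proof eventually_elim
        case (elim m)
        have "card {n\<in>S. n \<le> m} \<le> card S" using fin by (intro card_mono) auto
        with elim show ?case by linarith
      qed
      then show False by simp
    qed
    have q_card: "card {n\<in>S. n \<le> q N} = N" if "N \<ge> 1" for N
      using card_le_enumerate[OF inf, of "N - 1"] that
      by (simp add: q_def pseudo_prime_def S_def)
    \<comment> \<open>By truncated subtraction \<open>q 0 = q 1\<close>, so growth is shown at
      successors and then shifted.\<close>
    have "N \<le> q (Suc N)" for N
      using le_enumerate[OF inf, of N] by (simp add: q_def pseudo_prime_def S_def)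
    then have "filterlim (\<lambda>N. q (Suc N)) at_top sequentially"
      by (intro filterlim_at_top_mono[OF filterlim_ident]) auto
    then have q_lim: "filterlim q at_top sequentially"
      by (simp add: filterlim_sequentially_Suc)
    have C_eq: "pseudo_C k \<theta> (\<lambda>n. r n \<omega>) N = (\<Sum>n=3..q N. a n * X n \<omega>)" for N
      unfolding pseudo_C_def q_def
      by (intro sum.cong refl) (auto simp: pseudo_z_def X_def p_def a_eq)

    have "\<forall>\<^sub>F N in sequentially.
        \<bar>pseudo_C k \<theta> (\<lambda>n. r n \<omega>) N\<bar> \<le> (1 + 2 * real k) * real N powr (1/2 + \<epsilon>)"
      using eventually_compose_filterlim[OF devC q_lim]
        eventually_compose_filterlim[OF lower q_lim] eventually_ge_at_top[of 1]
    proof eventually_elim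
      case (elim N)
      \<comment> \<open>The count up to \<open>q N\<close> is exactly \<open>N\<close>, so
        \<open>lower\<close> bounds the inner power by \<open>N\<close>.\<close>
      have "real (q N) powr (1/2 + \<delta>) = (real (q N) powr (1 - \<delta>)) powr (1/2 + \<epsilon>)"
        by (simp add: \<delta>_eq powr_powr)
      also have "\<dots> \<le> real N powr (1/2 + \<epsilon>)"
        using elim(2) q_card[OF elim(3)] \<open>\<epsilon> > 0\<close> by (intro powr_mono2) auto
      finally have "\<bar>pseudo_C k \<theta> (\<lambda>n. r n \<omega>) N\<bar> \<le> real N powr (1/2 + \<epsilon>) + 2 * real k * 1"
        using elim(1) mean[of "q N"] unfolding C_eq by linarith
      also have "\<dots> \<le> real N powr (1/2 + \<epsilon>) + 2 * real k * real N powr (1/2 + \<epsilon>)"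
        using elim(3) \<open>\<epsilon> > 0\<close> by (intro add_left_mono mult_left_mono ge_one_powr_ge_zero) auto
      finally show ?case by (simp add: algebra_simps)
    qed
    then show "(\<lambda>N. pseudo_C k \<theta> (\<lambda>n. r n \<omega>) N) \<in> O(\<lambda>N. real N powr (1/2 + \<epsilon>))"
      by (intro bigoI[where c = "1 + 2 * real k"]) (auto elim!: eventually_mono)
  qed
qed

end
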